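(* Consider a $(K,F,r)$-computing matrix (of size $K\times F$) with a non-overlapping identity submatrix cover $\mathfrak{C}=\{C_1,\dots,C_S\}$ in which each identity submatrix has size $g\geq 2$. Let $\kappa'$ be such that $K-\kappa'\in\{0,1,\dots,g-2\}$. Then there exists a distributed computing scheme with $K$ nodes that is robust for $K-\kappa'$ partial stragglers, attaining computation load $r$ and communication load $L(\kappa')=\frac{2}{g}\left(1-\frac{r}{K}\right)$, with file complexity $F$.
   Context: Identity submatrices: an $l\times l$ submatrix $B$ of a binary ($0/1$) matrix $A$ is an identity submatrix of size $l$ if its columns are those of the $l\times l$ identity matrix in some order, i.e. $B$ is a permutation matrix. An entry $A(i,j)=1$ is covered by $B$ if $i$ is a row index and $j$ a column index of $B$. A set $\{C_1,\dots,C_S\}$ of identity submatrices of $A$ is an identity submatrix cover of $A$ if each non-zero entry of $A$ is covered by at least one $C_i$; it is non-overlapping if no non-zero entry is covered by two distinct members. Computing matrix: a binary matrix $C$ with rows indexed by a $K$-set $\mathcal{K}$ and columns by an $F$-set $\mathcal{F}$ such that each column has the same number $r$ of $0$'s is a $(K,F,r)$-computing matrix; it defines the assignment in which subfile $f$ is assigned to server $k$ if $C(k,f)=0$ and not assigned if $C(k,f)=1$. Coded MapReduce model with partial stragglers: there are $K$ servers (nodes) indexed by $\mathcal{K}$, and an input file divided into $F$ subfiles indexed by $\mathcal{F}$, $|\mathcal{F}|=F\geq K$; $F$ is the file complexity. There are $Q=\beta K$ output functions, $\beta$ an integer. For $q\in[Q]$, $f\in\mathcal{F}$ there is an intermediate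 value (IVA) $v_{q,f}$, an arbitrary string of $T$ bits, computable from subfile $f$; the $q$-th output function is computed (reduced) from $\{v_{q,f}:f\in\mathcal{F}\}$. Each subfile is assigned to $r$ servers ($r$ is the computation load); $\mathcal{M}_k$ denotes the subfiles assigned to server $k$. Every server $k\in\mathcal{K}$ (straggler or not) must reduce $\beta$ functions $\mathcal{W}_k=\{q_{(k,b)}:b\in[\beta]\}$, these sets being disjoint with union $[Q]$. The map phase, for a scheme based on a computing matrix $C$ with cover $\mathfrak{C}$, has three sub-phases. Sub-phase 1: every server $k$ computes $v_{q,f}$ for $q\in\mathcal{W}_k$, $f\in\mathcal{M}_k$. Sub-phase 2: for every $C'\in\mathfrak{C}$ having $k$ among its row indices, with $1$-entries at positions $(k^1,f^1),\dots,(k^g,f^g)$, every server $k$ computes $v_{q_{(k',b)},f'}$ for all $b\in[\beta]$ and all of these positions $(k',f')$ other than the one with $k'=k$. Sub-phase 3: the first $\kappa'$ servers to finish sub-phases 1 and 2 (the active servers) compute $v_{q,f}$ for all $q\in[Q]$ and all their assigned subfiles $f$, if not already computed; the other $K-\kappa'$ servers (the partial stragglers) stop mapping after sub-phase 2. In the shuffle phase only active servers broadcast messages (each a function of the IVAs computed by the transmitting server); the partial stragglers transmit nothing. Afterwards every server $k$, including the partial stragglers, must be able to recover all $v_{q,f}$, $q\in\mathcal{W}_k$, $f\notin\mathcal{M}_k$, from the broadcasts and the IVAs it has computed, and then reduce the functions in $\mathcal{W}_k$. The scheme is robust for $K-\kappa'$ partial stragglers if this works for every set of $K-\kappa'$ servers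 as the set of partial stragglers. The communication load $L(\kappa')$ is $\frac{\text{number of bits transmitted in the shuffle phase}}{QFT}$ in the worst case over the sets of $K-\kappa'$ partial stragglers. *)

theory Defs
  imports Complex_Main "HOL-Library.FuncSet" "HOL-Library.Disjoint_Sets"
begin

text \<open>
  A matrix with rows indexed by a finite set \<open>Is\<close> and columns indexed by a finite set
  \<open>Js\<close> is a function; only its values on \<open>Is \<times> Js\<close> matter.
  A submatrix is the pair \<open>(R, D)\<close> of its row-index and column-index sets.
\<close>

definition binary_matrix :: "'i set \<Rightarrow> 'j set \<Rightarrow> ('i \<Rightarrow> 'j \<Rightarrow> nat) \<Rightarrow> bool" where
  "binary_matrix Is Js A \<longleftrightarrow>
     finite Is \<and> finite Js \<and> (\<forall>i\<in>Is. \<forall>j\<in>Js. A i j \<in> {0, 1})"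

definition computing_matrix ::
    "'k set \<Rightarrow> 'f set \<Rightarrow> nat \<Rightarrow> nat \<Rightarrow> nat \<Rightarrow> ('k \<Rightarrow> 'f \<Rightarrow> nat) \<Rightarrow> bool" where
  "computing_matrix Ks Fs K F r C \<longleftrightarrow>
     binary_matrix Ks Fs C \<and> card Ks = K \<and> card Fs = F \<and>
     (\<forall>f\<in>Fs. card {k\<in>Ks. C k f = 0} = r)"

text \<open>
  The bijection says which column of the identity matrix each column of the submatrix is:
  column \<open>j\<close> is the unit vector with its 1 in row \<open>\<sigma> j\<close>.
\<close>

definition identity_submatrix ::
    "'i set \<Rightarrow> 'j set \<Rightarrow> ('i \<Rightarrow> 'j \<Rightarrow> nat) \<Rightarrow> nat \<Rightarrow> 'i set \<times> 'j set \<Rightarrow> bool" where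
  "identity_submatrix Is Js A l B \<longleftrightarrow>
     (case B of (R, D) \<Rightarrow>
        R \<subseteq> Is \<and> D \<subseteq> Js \<and> card R = l \<and> card D = l \<and>
        (\<exists>\<sigma>. bij_betw \<sigma> D R \<and>
             (\<forall>i\<in>R. \<forall>j\<in>D. A i j = (if i = \<sigma> j then 1 else 0))))"

definition covers :: "('i \<Rightarrow> 'j \<Rightarrow> nat) \<Rightarrow> 'i set \<times> 'j set \<Rightarrow> 'i \<Rightarrow> 'j \<Rightarrow> bool" where
  "covers A B i j \<longleftrightarrow> A i j = 1 \<and> i \<in> fst B \<and> j \<in> snd B"

definition identity_submatrix_cover ::
    "'i set \<Rightarrow> 'j set \<Rightarrow> ('i \<Rightarrow> 'j \<Rightarrow> nat) \<Rightarrow> ('i set \<times> 'j set) set \<Rightarrow> bool" where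
  "identity_submatrix_cover Is Js A Cov \<longleftrightarrow>
     (\<forall>B\<in>Cov. \<exists>l. identity_submatrix Is Js A l B) \<and>
     (\<forall>i\<in>Is. \<forall>j\<in>Js. A i j \<noteq> 0 \<longrightarrow> (\<exists>B\<in>Cov. covers A B i j))"

definition non_overlapping ::
    "'i set \<Rightarrow> 'j set \<Rightarrow> ('i \<Rightarrow> 'j \<Rightarrow> nat) \<Rightarrow> ('i set \<times> 'j set) set \<Rightarrow> bool" where
  "non_overlapping Is Js A Cov \<longleftrightarrow>
     (\<forall>i\<in>Is. \<forall>j\<in>Js. A i j \<noteq> 0 \<longrightarrow>
        \<not> (\<exists>B\<in>Cov. \<exists>B'\<in>Cov. B \<noteq> B' \<and> covers A B i j \<and> covers A B' i j))"

text \<open>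
  The IVA \<open>v\<^bsub>q,f\<^esub>\<close> is addressed by the pair \<open>(q, f)\<close>; bit strings are lists of Booleans.
  The number \<open>q\<^bsub>(k,b)\<^esub>\<close> is \<open>fn J k b\<close>, with \<open>b\<close> ranging over \<open>{1..beta J}\<close>, and
  \<open>output_fun J q\<close> computes the \<open>q\<close>-th output from the IVAs of all subfiles.
\<close>

record ('k, 'f, 'o) job =
  nodes :: "'k set"
  subfiles :: "'f set"
  beta :: nat
  iva_bits :: nat
  fn :: "'k \<Rightarrow> nat \<Rightarrow> nat"
  output_fun :: "nat \<Rightarrow> ('f \<Rightarrow> bool list) \<Rightarrow> 'o"

definition num_functions :: "('k, 'f, 'o) job \<Rightarrow> nat" where
  "num_functions J = beta J * card (nodes J)"

definition reduce_set :: "('k, 'f, 'o) job \<Rightarrow> 'k \<Rightarrow> nat set" where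
  "reduce_set J k = fn J k ` {1..beta J}"

definition valid_job :: "('k, 'f, 'o) job \<Rightarrow> bool" where
  "valid_job J \<longleftrightarrow>
     finite (nodes J) \<and> nodes J \<noteq> {} \<and> finite (subfiles J) \<and>
     card (nodes J) \<le> card (subfiles J) \<and> beta J \<ge> 1 \<and> iva_bits J \<ge> 1 \<and>
     disjoint_family_on (reduce_set J) (nodes J) \<and>
     (\<Union>k\<in>nodes J. reduce_set J k) = {1..num_functions J}"

definition iva_family :: "('k, 'f, 'o) job \<Rightarrow> (nat \<times> 'f \<Rightarrow> bool list) \<Rightarrow> bool" where
  "iva_family J v \<longleftrightarrow>
     (\<forall>q\<in>{1..num_functions J}. \<forall>f\<in>subfiles J. length (v (q, f)) = iva_bits J)"

text \<open>
  \<open>early_ivas Sc k\<close> are the IVAs computed by server \<open>k\<close> whether or not it turns out to be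
  a straggler, so they cannot depend on the set of stragglers.  The argument of type
  \<open>'k set\<close> of the remaining fields is the set of partial stragglers.  All transmissions
  of a server are concatenated into one message of \<open>msg_bits\<close> bits.  Encoders and decoders
  see IVAs and broadcasts only through partial functions that are undefined on whatever the
  server has not computed, respectively on the servers that do not transmit.
\<close>

record ('k, 'f) scheme =
  assigned :: "'k \<Rightarrow> 'f set"
  early_ivas :: "'k \<Rightarrow> (nat \<times> 'f) set"
  msg_bits :: "'k set \<Rightarrow> 'k \<Rightarrow> nat"
  encode :: "'k set \<Rightarrow> 'k \<Rightarrow> (nat \<times> 'f \<rightharpoonup> bool list) \<Rightarrow> bool list"
  decode :: "'k set \<Rightarrow> 'k \<Rightarrow> ('k \<rightharpoonup> bool list) \<Rightarrow> (nat \<times> 'f \<rightharpoonup> bool list)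
               \<Rightarrow> nat \<times> 'f \<Rightarrow> bool list"

definition subphase1 ::
    "('k, 'f, 'o) job \<Rightarrow> ('k \<Rightarrow> 'f \<Rightarrow> nat) \<Rightarrow> 'k \<Rightarrow> (nat \<times> 'f) set" where
  "subphase1 J C k = reduce_set J k \<times> {f \<in> subfiles J. C k f = 0}"

definition subphase2 ::
    "('k, 'f, 'o) job \<Rightarrow> ('k \<Rightarrow> 'f \<Rightarrow> nat) \<Rightarrow> ('k set \<times> 'f set) set \<Rightarrow> 'k
       \<Rightarrow> (nat \<times> 'f) set" where
  "subphase2 J C Cov k =
     {(fn J k' b, f') | R D k' f' b.
        (R, D) \<in> Cov \<and> k \<in> R \<and> k' \<in> R \<and> f' \<in> D \<and> C k' f' = 1 \<and> k' \<noteq> k \<and>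
        b \<in> {1..beta J}}"

definition based_on ::
    "('k, 'f, 'o) job \<Rightarrow> ('k \<Rightarrow> 'f \<Rightarrow> nat) \<Rightarrow> ('k set \<times> 'f set) set
       \<Rightarrow> ('k, 'f) scheme \<Rightarrow> bool" where
  "based_on J C Cov Sc \<longleftrightarrow>
     (\<forall>k\<in>nodes J. assigned Sc k = {f \<in> subfiles J. C k f = 0} \<and>
                   early_ivas Sc k = subphase1 J C k \<union> subphase2 J C Cov k)"

definition computed_ivas ::
    "('k, 'f, 'o) job \<Rightarrow> ('k, 'f) scheme \<Rightarrow> 'k set \<Rightarrow> 'k \<Rightarrow> (nat \<times> 'f) set" where
  "computed_ivas J Sc P k =
     early_ivas Sc k \<union> (if k \<in> P then {} else {1..num_functions J} \<times> assigned Sc k)"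

text \<open>\<open>\<kappa>\<close> is the number of active servers, not of stragglers.\<close>

definition straggler_sets :: "('k, 'f, 'o) job \<Rightarrow> nat \<Rightarrow> 'k set set" where
  "straggler_sets J \<kappa> = {P. P \<subseteq> nodes J \<and> card P = card (nodes J) - \<kappa>}"

definition local_view ::
    "('k, 'f, 'o) job \<Rightarrow> ('k, 'f) scheme \<Rightarrow> 'k set \<Rightarrow> (nat \<times> 'f \<Rightarrow> bool list) \<Rightarrow> 'k
       \<Rightarrow> (nat \<times> 'f \<rightharpoonup> bool list)" where
  "local_view J Sc P v k = (\<lambda>x. if x \<in> computed_ivas J Sc P k then Some (v x) else None)"

definition broadcasts ::
    "('k, 'f, 'o) job \<Rightarrow> ('k, 'f) scheme \<Rightarrow> 'k set \<Rightarrow> (nat \<times> 'f \<Rightarrow> bool list)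
       \<Rightarrow> ('k \<rightharpoonup> bool list)" where
  "broadcasts J Sc P v =
     (\<lambda>k. if k \<in> nodes J - P then Some (encode Sc P k (local_view J Sc P v k)) else None)"

definition decoded_iva ::
    "('k, 'f, 'o) job \<Rightarrow> ('k, 'f) scheme \<Rightarrow> 'k set \<Rightarrow> (nat \<times> 'f \<Rightarrow> bool list) \<Rightarrow> 'k
       \<Rightarrow> nat \<Rightarrow> 'f \<Rightarrow> bool list" where
  "decoded_iva J Sc P v k q f =
     decode Sc P k (broadcasts J Sc P v) (local_view J Sc P v k) (q, f)"

definition gathered_iva ::
    "('k, 'f, 'o) job \<Rightarrow> ('k, 'f) scheme \<Rightarrow> 'k set \<Rightarrow> (nat \<times> 'f \<Rightarrow> bool list) \<Rightarrow> 'k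
       \<Rightarrow> nat \<Rightarrow> 'f \<Rightarrow> bool list" where
  "gathered_iva J Sc P v k q f =
     (if f \<in> assigned Sc k then the (local_view J Sc P v k (q, f))
      else decoded_iva J Sc P v k q f)"

definition recovers ::
    "('k, 'f, 'o) job \<Rightarrow> ('k, 'f) scheme \<Rightarrow> 'k set \<Rightarrow> (nat \<times> 'f \<Rightarrow> bool list) \<Rightarrow> 'k \<Rightarrow> bool"
  where
  "recovers J Sc P v k \<longleftrightarrow>
     (\<forall>q\<in>reduce_set J k. \<forall>f\<in>subfiles J - assigned Sc k. decoded_iva J Sc P v k q f = v (q, f))"

definition reduces ::
    "('k, 'f, 'o) job \<Rightarrow> ('k, 'f) scheme \<Rightarrow> 'k set \<Rightarrow> (nat \<times> 'f \<Rightarrow> bool list) \<Rightarrow> 'k \<Rightarrow> bool"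
  where
  "reduces J Sc P v k \<longleftrightarrow>
     (\<forall>q\<in>reduce_set J k.
        output_fun J q (\<lambda>f\<in>subfiles J. gathered_iva J Sc P v k q f) =
        output_fun J q (\<lambda>f\<in>subfiles J. v (q, f)))"

text \<open>
  A server can only compute IVAs of subfiles assigned to it, and the length of a message may
  depend on the set of stragglers but not on the values of the IVAs.
\<close>

definition valid_scheme :: "('k, 'f, 'o) job \<Rightarrow> ('k, 'f) scheme \<Rightarrow> nat \<Rightarrow> bool" where
  "valid_scheme J Sc \<kappa> \<longleftrightarrow>
     (\<forall>k\<in>nodes J. assigned Sc k \<subseteq> subfiles J \<and>
                   early_ivas Sc k \<subseteq> {1..num_functions J} \<times> assigned Sc k) \<and>
     (\<forall>P\<in>straggler_sets J \<kappa>. \<forall>k\<in>nodes J - P. \<forall>v. iva_family J v \<longrightarrow>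
        length (encode Sc P k (local_view J Sc P v k)) = msg_bits Sc P k)"

definition robust :: "('k, 'f, 'o) job \<Rightarrow> ('k, 'f) scheme \<Rightarrow> nat \<Rightarrow> bool" where
  "robust J Sc \<kappa> \<longleftrightarrow>
     (\<forall>P\<in>straggler_sets J \<kappa>. \<forall>v. iva_family J v \<longrightarrow>
        (\<forall>k\<in>nodes J. recovers J Sc P v k \<and> reduces J Sc P v k))"

definition has_computation_load :: "('k, 'f, 'o) job \<Rightarrow> ('k, 'f) scheme \<Rightarrow> nat \<Rightarrow> bool" where
  "has_computation_load J Sc r \<longleftrightarrow>
     (\<forall>f\<in>subfiles J. card {k \<in> nodes J. f \<in> assigned Sc k} = r)"

definition communication_load :: "('k, 'f, 'o) job \<Rightarrow> ('k, 'f) scheme \<Rightarrow> nat \<Rightarrow> real" where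
  "communication_load J Sc \<kappa> =
     Max ((\<lambda>P. real (\<Sum>k\<in>nodes J - P. msg_bits Sc P k)
                / real (num_functions J * card (subfiles J) * iva_bits J))
          ` straggler_sets J \<kappa>)"

end

theory Submission
  imports Defs
begin

text \<open>
  In an identity submatrix with at most \<open>g - 2\<close> stragglers at least two of its \<open>g\<close> servers are
  active.  Each of two active servers \<open>s\<close> broadcasts, for every \<open>b\<close>, the XOR of the IVAs
  belonging to the other \<open>g - 1\<close> one-entries of the submatrix, all of which \<open>s\<close> knows after
  sub-phase 2.  A server \<open>k \<noteq> s\<close> of the submatrix knows every summand except its own and
  cancels them; \<open>s\<close> itself is served by the other sender.  So each submatrix costs exactly
  \<open>2\<beta>T\<close> bits, and double counting the one-entries gives \<open>g |Cov| = F (K - r)\<close>.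
\<close>

section \<open>The coded scheme: senders, chunks and messages\<close>

text \<open>In an identity submatrix each row has exactly one 1, so the \<open>THE\<close> is
  meaningful there: it is the inverse of \<sigma> at \<open>k\<close>, the only subfile among the
  columns of \<open>B\<close> that server \<open>k\<close> lacks.\<close>

definition column_of :: "('k \<Rightarrow> 'f \<Rightarrow> nat) \<Rightarrow> 'k set \<times> 'f set \<Rightarrow> 'k \<Rightarrow> 'f" where
  "column_of C B k = (THE f. f \<in> snd B \<and> C k f = 1)"

text \<open>Exactly two senders are fixed even if more are active, so that a submatrix costs the
  same for every \<open>P\<close>. The choice depends on \<open>P\<close> and \<open>B\<close> only,
  not on IVA values.\<close>

definition senders :: "'k set \<Rightarrow> 'k set \<times> 'f set \<Rightarrow> 'k set" where
  "senders P B = (SOME A. A \<subseteq> fst B - P \<and> card A = 2)"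

definition chunks ::
    "('k, 'f, 'o) job \<Rightarrow> ('k set \<times> 'f set) set \<Rightarrow> 'k set \<Rightarrow> 'k
       \<Rightarrow> (('k set \<times> 'f set) \<times> nat) set" where
  "chunks J Cov P k = {B \<in> Cov. k \<in> senders P B} \<times> {1..beta J}"

text \<open>The order is independent of the IVAs, so the messages arising from two IVA families can
  be compared chunk by chunk.\<close>

definition chunk_list ::
    "('k, 'f, 'o) job \<Rightarrow> ('k set \<times> 'f set) set \<Rightarrow> 'k set \<Rightarrow> 'k
       \<Rightarrow> (('k set \<times> 'f set) \<times> nat) list" where
  "chunk_list J Cov P k = (SOME xs. set xs = chunks J Cov P k \<and> distinct xs)"

text \<open>The XOR of bits is the parity of the number of ones.\<close>

definition coded_chunk ::
    "('k, 'f, 'o) job \<Rightarrow> ('k \<Rightarrow> 'f \<Rightarrow> nat) \<Rightarrow> 'k \<Rightarrow> (nat \<times> 'f \<rightharpoonup> bool list)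
       \<Rightarrow> ('k set \<times> 'f set) \<times> nat \<Rightarrow> bool list" where
  "coded_chunk J C k w x =
     map (\<lambda>i. odd (card {k' \<in> fst (fst x) - {k}.
                          the (w (fn J k' (snd x), column_of C (fst x) k')) ! i}))
       [0..<iva_bits J]"

definition coded_message ::
    "('k, 'f, 'o) job \<Rightarrow> ('k \<Rightarrow> 'f \<Rightarrow> nat) \<Rightarrow> ('k set \<times> 'f set) set \<Rightarrow> 'k set \<Rightarrow> 'k
       \<Rightarrow> (nat \<times> 'f \<rightharpoonup> bool list) \<Rightarrow> bool list" where
  "coded_message J C Cov P k w = concat (map (coded_chunk J C k w) (chunk_list J Cov P k))"

text \<open>\<open>decode\<close> is a placeholder: the eventual decoder is defined from broadcasts
  and local views, so the other fields have to be fixed first.\<close>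

definition coded_scheme_without_decoder ::
    "('k, 'f, 'o) job \<Rightarrow> ('k \<Rightarrow> 'f \<Rightarrow> nat) \<Rightarrow> ('k set \<times> 'f set) set \<Rightarrow> ('k, 'f) scheme" where
  "coded_scheme_without_decoder J C Cov =
     \<lparr>assigned = (\<lambda>k. {f \<in> subfiles J. C k f = 0}),
      early_ivas = (\<lambda>k. subphase1 J C k \<union> subphase2 J C Cov k),
      msg_bits = (\<lambda>P k. iva_bits J * card (chunks J Cov P k)),
      encode = coded_message J C Cov,
      decode = (\<lambda>_ _ _ _ _. [])\<rparr>"

text \<open>
  The decoder may return the value at \<open>x\<close> of any IVA family consistent with what the server
  observes; neither broadcasts nor local views depend on the \<open>decode\<close> field.
\<close>

definition with_consistent_decoder ::
    "('k, 'f, 'o) job \<Rightarrow> ('k, 'f) scheme \<Rightarrow> ('k, 'f) scheme" where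
  "with_consistent_decoder J Sc =
     Sc\<lparr>decode := (\<lambda>P k m w x.
       (SOME v. iva_family J v \<and> broadcasts J Sc P v = m \<and> local_view J Sc P v k = w) x)\<rparr>"

section \<open>Decoding by consistency\<close>

lemma with_consistent_decoder_simps [simp]:
  "assigned (with_consistent_decoder J Sc) = assigned Sc"
  "early_ivas (with_consistent_decoder J Sc) = early_ivas Sc"
  "msg_bits (with_consistent_decoder J Sc) = msg_bits Sc"
  "encode (with_consistent_decoder J Sc) = encode Sc"
  by (simp_all add: with_consistent_decoder_def)

lemma observations_with_consistent_decoder [simp]:
  "computed_ivas J' (with_consistent_decoder J Sc) = computed_ivas J' Sc"
  "local_view J' (with_consistent_decoder J Sc) = local_view J' Sc"
  "broadcasts J' (with_consistent_decoder J Sc) = broadcasts J' Sc"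
  by (simp_all add: computed_ivas_def local_view_def broadcasts_def fun_eq_iff)

text \<open>This reduces decoding to determinacy. The choice exists because \<open>v\<close> itself
  is consistent with the observations, and whichever \<open>u\<close> is chosen agrees with
  \<open>v\<close> on the wanted IVAs by \<open>det\<close>.\<close>

lemma recovers_with_consistent_decoder:
  assumes fam: "iva_family J v"
    and det: "\<And>u q f. \<lbrakk>iva_family J u; broadcasts J Sc P u = broadcasts J Sc P v;
        local_view J Sc P u k = local_view J Sc P v k; q \<in> reduce_set J k;
        f \<in> subfiles J - assigned Sc k\<rbrakk> \<Longrightarrow> u (q, f) = v (q, f)"
  shows "recovers J (with_consistent_decoder J Sc) P v k"
proof -
  define u where "u = (SOME u. iva_family J u \<and> broadcasts J Sc P u = broadcasts J Sc P v
    \<and> local_view J Sc P u k = local_view J Sc P v k)"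
  have "iva_family J u \<and> broadcasts J Sc P u = broadcasts J Sc P v
    \<and> local_view J Sc P u k = local_view J Sc P v k"
    unfolding u_def by (rule someI [of _ v]) (simp add: fam)
  \<comment> \<open>The first \<open>simp\<close> turns observations of the modified scheme into
    those of \<open>Sc\<close>, for which the definition must stay folded; the second exposes the
    decoder.\<close>
  moreover have "decoded_iva J (with_consistent_decoder J Sc) P v k q f = u (q, f)" for q f
    by (simp add: decoded_iva_def u_def) (simp add: with_consistent_decoder_def)
  ultimately show ?thesis
    by (simp add: recovers_def det)
qed

text \<open>IVAs of unassigned subfiles are recovered; those of assigned subfiles are computed early
  even by a straggler, so \<open>the\<close> never meets \<open>None\<close>.\<close>

lemma reduces_if_recovers:
  assumes "recovers J Sc P v k"
    and "reduce_set J k \<times> assigned Sc k \<subseteq> early_ivas Sc k"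
  shows "reduces J Sc P v k"
  unfolding reduces_def
proof (intro ballI arg_cong [where f = "output_fun J _"] restrict_ext)
  fix q f assume "q \<in> reduce_set J k" "f \<in> subfiles J"
  then show "gathered_iva J Sc P v k q f = v (q, f)"
    using assms by (auto simp: gathered_iva_def recovers_def local_view_def computed_ivas_def)
qed

section \<open>Splitting messages and cancelling in XORs\<close>

text \<open>Equal block lengths fix the boundaries between blocks, so the concatenation can be cut
  apart again.\<close>

lemma concat_map_eq_imp_eq:
  assumes "concat (map h xs) = concat (map h' xs)"
    and "\<And>x. x \<in> set xs \<Longrightarrow> length (h x) = length (h' x)" and "x \<in> set xs"
  shows "h x = h' x"
  using assms
proof (induction xs)
  case (Cons y ys)
  then have "h y = h' y" "concat (map h ys) = concat (map h' ys)"
    by simp_all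
  then show ?case
    using Cons.IH Cons.prems(2,3) by (metis list.set_intros(2) set_ConsD)
qed simp

text \<open>Cancellation for XOR in terms of parities: away from \<open>a\<close> the filtered sets
  coincide, and including \<open>a\<close> flips the parity.\<close>

lemma odd_card_filter_cancel:
  assumes "finite A" "a \<in> A" and "\<And>x. x \<in> A - {a} \<Longrightarrow> p x = p' x"
    and "odd (card {x \<in> A. p x}) = odd (card {x \<in> A. p' x})"
  shows "p a = p' a"
proof -
  have split: "card {x \<in> A. h x} = card {x \<in> A - {a}. h x} + of_bool (h a)" for h
  proof -
    have "{x \<in> A. h x} = (if h a then insert a {x \<in> A - {a}. h x} else {x \<in> A - {a}. h x})"
      using \<open>a \<in> A\<close> by auto
    then show ?thesis
      using \<open>finite A\<close> by simp
  qed
  have "{x \<in> A - {a}. p x} = {x \<in> A - {a}. p' x}"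
    using assms(3) by blast
  then show ?thesis
    using assms(4) unfolding split [of p] split [of p'] by (cases "p a"; cases "p' a") auto
qed

section \<open>Message lengths and existence of senders\<close>

lemma chunk_list:
  assumes "finite Cov"
  shows "set (chunk_list J Cov P k) = chunks J Cov P k" "distinct (chunk_list J Cov P k)"
proof -
  have "finite (chunks J Cov P k)"
    using assms by (simp add: chunks_def)
  then have "set (chunk_list J Cov P k) = chunks J Cov P k \<and> distinct (chunk_list J Cov P k)"
    unfolding chunk_list_def by (rule someI_ex [OF finite_distinct_list])
  then show "set (chunk_list J Cov P k) = chunks J Cov P k" "distinct (chunk_list J Cov P k)"
    by blast+
qed

lemma length_coded_chunk [simp]: "length (coded_chunk J C k w x) = iva_bits J"
  by (simp add: coded_chunk_def)

lemma length_coded_message: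
  assumes "finite Cov"
  shows "length (coded_message J C Cov P k w) = iva_bits J * card (chunks J Cov P k)"
proof -
  have "length (coded_message J C Cov P k w) = length (chunk_list J Cov P k) * iva_bits J"
    by (simp add: coded_message_def length_concat o_def sum_list_triv)
  also have "length (chunk_list J Cov P k) = card (chunks J Cov P k)"
    using chunk_list [OF assms] by (metis distinct_card)
  finally show ?thesis
    by simp
qed

text \<open>Even if all of \<open>P\<close> lies among the rows of \<open>B\<close>, two rows remain
  to choose from.\<close>

lemma senders:
  assumes "finite P" "card P + 2 \<le> card (fst B)"
  shows "senders P B \<subseteq> fst B - P" "card (senders P B) = 2"
proof -
  have "2 \<le> card (fst B - P)"
    using assms diff_card_le_card_Diff [of P "fst B"] by linarith
  then have "\<exists>A. A \<subseteq> fst B - P \<and> card A = 2"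
    using obtain_subset_with_card_n by metis
  then have "senders P B \<subseteq> fst B - P \<and> card (senders P B) = 2"
    unfolding senders_def by (rule someI_ex)
  then show "senders P B \<subseteq> fst B - P" "card (senders P B) = 2"
    by blast+
qed

section \<open>Rows and columns of an identity submatrix\<close>

lemma identity_submatrix_row_unique:
  assumes "identity_submatrix Ks Fs C g B" "k \<in> fst B"
  shows "\<exists>!f. f \<in> snd B \<and> C k f = 1"
proof -
  obtain R D \<sigma> where B: "B = (R, D)" "bij_betw \<sigma> D R"
    "\<forall>i\<in>R. \<forall>j\<in>D. C i j = (if i = \<sigma> j then 1 else 0)"
    using assms(1) by (auto simp: identity_submatrix_def split: prod.splits)
  have "(f \<in> snd B \<and> C k f = 1) \<longleftrightarrow> f \<in> D \<and> \<sigma> f = k" for f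
    proof (cases "f \<in> D")
    case True
    moreover have "k \<in> R"
      using B(1) assms(2) by simp
    ultimately have "C k f = (if k = \<sigma> f then 1 else 0)"
      using B(3) by blast
    then show ?thesis
      using B(1) True by auto
  qed (simp add: B(1))
  moreover have "\<exists>!f. f \<in> D \<and> \<sigma> f = k"
    using B(1,2) assms(2) by (fastforce simp: bij_betw_def inj_on_def)
  ultimately show ?thesis
    by simp
qed

lemma column_of:
  assumes "identity_submatrix Ks Fs C g B" "k \<in> fst B"
  shows "column_of C B k \<in> snd B" "C k (column_of C B k) = 1"
  using theI' [OF identity_submatrix_row_unique [OF assms]] unfolding column_of_def by blast+

lemma column_of_eq:
  assumes "identity_submatrix Ks Fs C g B" "k \<in> fst B" "f \<in> snd B" "C k f = 1"
  shows "column_of C B k = f"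
  using identity_submatrix_row_unique [OF assms(1,2)] column_of [OF assms(1,2)] assms(3,4)
  by blast

text \<open>A column of the submatrix contains a single 1. Hence the subfiles used by a server in
  sub-phase 2 are all assigned to it.\<close>

lemma identity_submatrix_zero:
  assumes "identity_submatrix Ks Fs C g (R, D)" "k \<in> R" "k' \<in> R" "f \<in> D" "C k' f = 1" "k \<noteq> k'"
  shows "C k f = 0"
proof -
  obtain \<sigma> where "\<forall>i\<in>R. \<forall>j\<in>D. C i j = (if i = \<sigma> j then 1 else 0)"
    using assms(1) by (auto simp: identity_submatrix_def)
  then have "C k f = (if k = \<sigma> f then 1 else 0)" "C k' f = (if k' = \<sigma> f then 1 else 0)"
    using assms(2-4) by blast+
  then show ?thesis
    using assms(5,6) by (simp split: if_splits)
qed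

section \<open>Double counting of one-entries and chunks\<close>

text \<open>Each of the \<open>g\<close> rows contributes exactly one entry, located by
  \<open>column_of\<close>.\<close>

lemma card_covered_entries:
  assumes "identity_submatrix Ks Fs C g B"
  shows "card {(k, f). covers C B k f} = g"
proof -
  have "{(k, f). covers C B k f} = (\<lambda>k. (k, column_of C B k)) ` fst B"
    using column_of [OF assms] column_of_eq [OF assms] by (fastforce simp: covers_def)
  moreover have "inj_on (\<lambda>k. (k, column_of C B k)) (fst B)"
    by (simp add: inj_on_def)
  ultimately show ?thesis
    using assms by (auto simp: card_image identity_submatrix_def split: prod.splits)
qed

lemma card_ones_computing_matrix:
  assumes "computing_matrix Ks Fs K F r C"
  shows "card {(k, f). k \<in> Ks \<and> f \<in> Fs \<and> C k f = 1} = F * (K - r)"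
proof -
  have fin: "finite Ks" "finite Fs" and bin: "\<forall>i\<in>Ks. \<forall>j\<in>Fs. C i j \<in> {0, 1}"
    and cards: "card Ks = K" "card Fs = F" "\<forall>f\<in>Fs. card {k \<in> Ks. C k f = 0} = r"
    using assms by (auto simp: computing_matrix_def binary_matrix_def)
  have col: "card {k \<in> Ks. C k f = 1} = K - r" if "f \<in> Fs" for f
  proof -
    have "{k \<in> Ks. C k f = 1} = Ks - {k \<in> Ks. C k f = 0}"
      using bin that by force
    then show ?thesis
      using fin cards that by (simp add: card_Diff_subset)
  qed
  \<comment> \<open>The pairs are swapped because the known counts are per column.\<close>
  have "{(k, f). k \<in> Ks \<and> f \<in> Fs \<and> C k f = 1} = prod.swap ` (SIGMA f:Fs. {k \<in> Ks. C k f = 1})"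
    by auto
  then show ?thesis
    using fin cards col by (simp add: card_image)
qed

lemma finite_cover:
  assumes "\<forall>B\<in>Cov. identity_submatrix Ks Fs C g B" "finite Ks" "finite Fs"
  shows "finite Cov"
proof (rule finite_subset)
  show "Cov \<subseteq> Pow Ks \<times> Pow Fs"
    using assms(1) by (auto simp: identity_submatrix_def)
qed (use assms in simp)

text \<open>Non-overlap makes the entry sets of the members disjoint, and the cover property makes
  their union the set of all one-entries; each member accounts for \<open>g\<close> of them.\<close>

lemma card_cover:
  assumes cm: "computing_matrix Ks Fs K F r C"
    and cov: "identity_submatrix_cover Ks Fs C Cov"
    and no: "non_overlapping Ks Fs C Cov"
    and sub: "\<forall>B\<in>Cov. identity_submatrix Ks Fs C g B"
  shows "g * card Cov = F * (K - r)"
proof -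
  have fin: "finite Ks" "finite Fs"
    using cm by (auto simp: computing_matrix_def binary_matrix_def)
  let ?E = "\<lambda>B. {(k, f). covers C B k f}"
  have inside: "k \<in> Ks" "f \<in> Fs" "C k f = 1" if "B \<in> Cov" "covers C B k f" for B k f
    using that bspec [OF sub that(1)]
    by (auto simp: covers_def identity_submatrix_def split: prod.splits)
  have "finite (?E B)" if "B \<in> Cov" for B
    by (rule finite_subset [of _ "Ks \<times> Fs"]) (use inside [OF that] fin in auto)
  moreover have "?E B \<inter> ?E B' = {}" if "B \<in> Cov" "B' \<in> Cov" "B \<noteq> B'" for B B'
  proof -
    have False if kf: "covers C B k f" "covers C B' k f" for k f
      using no inside [OF \<open>B \<in> Cov\<close> kf(1)] kf \<open>B \<in> Cov\<close> \<open>B' \<in> Cov\<close> \<open>B \<noteq> B'\<close>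
      unfolding non_overlapping_def by (metis one_neq_zero)
    then show ?thesis
      by blast
  qed
  ultimately have "card (\<Union>B\<in>Cov. ?E B) = (\<Sum>B\<in>Cov. card (?E B))"
    using finite_cover [OF sub fin] by (intro card_UN_disjoint) auto
  also have "\<dots> = (\<Sum>B\<in>Cov. g)"
    using sub card_covered_entries by (intro sum.cong refl) blast
  also have "(\<Union>B\<in>Cov. ?E B) = {(k, f). k \<in> Ks \<and> f \<in> Fs \<and> C k f = 1}"
  proof (intro equalityI subsetI)
    fix x assume "x \<in> (\<Union>B\<in>Cov. ?E B)"
    then show "x \<in> {(k, f). k \<in> Ks \<and> f \<in> Fs \<and> C k f = 1}"
      using inside by blast
  next
    fix x assume "x \<in> {(k, f). k \<in> Ks \<and> f \<in> Fs \<and> C k f = 1}"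
    then show "x \<in> (\<Union>B\<in>Cov. ?E B)"
      using cov unfolding identity_submatrix_cover_def by force
  qed
  finally show ?thesis
    using card_ones_computing_matrix [OF cm] by (simp add: mult.commute)
qed

text \<open>Exchanging the order of summation counts each submatrix once per sender, that is twice,
  for each of the \<open>beta J\<close> functions.\<close>

lemma sum_card_chunks:
  assumes "finite Ks" "finite Cov"
    and "\<And>B. B \<in> Cov \<Longrightarrow> senders P B \<subseteq> Ks - P \<and> card (senders P B) = 2"
  shows "(\<Sum>k\<in>Ks - P. card (chunks J Cov P k)) = 2 * beta J * card Cov"
proof -
  have "(\<Sum>k\<in>Ks - P. card {B \<in> Cov. k \<in> senders P B}) = (\<Sum>B\<in>Cov. card {k \<in> Ks - P. k \<in> senders P B})"
    using assms(1,2) by (intro sum_multicount_gen) auto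
  also have "\<dots> = (\<Sum>B\<in>Cov. 2)"
  proof (rule sum.cong)
    fix B assume "B \<in> Cov"
    then have "{k \<in> Ks - P. k \<in> senders P B} = senders P B"
      using assms(3) by blast
    then show "card {k \<in> Ks - P. k \<in> senders P B} = 2"
      using assms(3) \<open>B \<in> Cov\<close> by simp
  qed simp
  finally show ?thesis
    by (simp add: chunks_def card_cartesian_product flip: sum_distrib_right)
qed

section \<open>Recovery of a missing IVA\<close>

lemma subphase2I:
  assumes "identity_submatrix Ks Fs C g B" "B \<in> Cov" "k \<in> fst B" "k' \<in> fst B" "k' \<noteq> k"
    and "b \<in> {1..beta J}"
  shows "(fn J k' b, column_of C B k') \<in> subphase2 J C Cov k"
  using assms column_of [OF assms(1,4)] unfolding subphase2_def
  by (cases B) fastforce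

text \<open>Both families give the same XOR at \<open>s\<close>, and every summand except that of
  \<open>k\<close> is in the view of \<open>k\<close>, hence equal for both. Cancelling leaves the
  summand of \<open>k\<close>, which occurs in the XOR since \<open>k \<noteq> s\<close>.\<close>

lemma message_determines_missing_iva:
  assumes sub: "identity_submatrix (nodes J) (subfiles J) C g B" and B: "B \<in> Cov" "finite Cov"
    and "finite (fst B)" "b \<in> {1..beta J}"
    and s: "s \<in> senders P B" "s \<in> fst B" and k: "k \<in> fst B" "k \<noteq> s"
    and early: "\<And>k'. k' \<in> fst B \<Longrightarrow> subphase2 J C Cov k' \<subseteq> early_ivas Sc k'"
    and msg: "coded_message J C Cov P s (local_view J Sc P u s)
        = coded_message J C Cov P s (local_view J Sc P v s)"
    and view: "local_view J Sc P u k = local_view J Sc P v k"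
    and i: "i < iva_bits J"
  shows "u (fn J k b, column_of C B k) ! i = v (fn J k b, column_of C B k) ! i"
proof -
  let ?x = "\<lambda>k'. (fn J k' b, column_of C B k')"
  \<comment> \<open>Used for \<open>s\<close>, which can evaluate all summands of its XOR, and for
    \<open>k\<close>, which can cancel all summands but its own.\<close>
  have known: "?x k' \<in> computed_ivas J Sc P k0" if "k0 \<in> fst B" "k' \<in> fst B" "k' \<noteq> k0" for k0 k'
    using subphase2I [OF sub B(1) that \<open>b \<in> _\<close>] early [OF that(1)]
    by (auto simp: computed_ivas_def)
  have "(B, b) \<in> set (chunk_list J Cov P s)"
    using B s \<open>b \<in> _\<close> by (simp add: chunk_list chunks_def)
  then have "coded_chunk J C s (local_view J Sc P u s) (B, b)
      = coded_chunk J C s (local_view J Sc P v s) (B, b)"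
    using concat_map_eq_imp_eq [OF msg [unfolded coded_message_def]] by simp
  then have parity: "odd (card {k' \<in> fst B - {s}. the (local_view J Sc P u s (?x k')) ! i})
      = odd (card {k' \<in> fst B - {s}. the (local_view J Sc P v s (?x k')) ! i})"
    using i by (simp add: coded_chunk_def)
  have seen: "the (local_view J Sc P w s (?x k')) = w (?x k')" if "k' \<in> fst B - {s}" for w k'
    using known [of s k'] s that by (simp add: local_view_def)
  have "the (local_view J Sc P u s (?x k)) ! i = the (local_view J Sc P v s (?x k)) ! i"
  proof (rule odd_card_filter_cancel [OF _ _ _ parity])
    fix k' assume k': "k' \<in> fst B - {s} - {k}"
    then have "?x k' \<in> computed_ivas J Sc P k"
      using known [of k k'] k by simp
    then have "u (?x k') = v (?x k')"
      using fun_cong [OF view, of "?x k'"] by (simp add: local_view_def)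
    then show "the (local_view J Sc P u s (?x k')) ! i = the (local_view J Sc P v s (?x k')) ! i"
      using seen k' by simp
  qed (use k \<open>finite (fst B)\<close> in auto)
  then show ?thesis
    using seen k by simp
qed

section \<open>Validity, robustness and loads of the coded scheme\<close>

theorem theorem9:
  fixes J :: "('k, 'f, 'o) job"
    and C :: "'k \<Rightarrow> 'f \<Rightarrow> nat"
    and Cov :: "('k set \<times> 'f set) set"
    and K F r g \<kappa> :: nat
  assumes "valid_job J"
    and "computing_matrix (nodes J) (subfiles J) K F r C"
    and "identity_submatrix_cover (nodes J) (subfiles J) C Cov"
    and "non_overlapping (nodes J) (subfiles J) C Cov"
    and "\<forall>B\<in>Cov. identity_submatrix (nodes J) (subfiles J) C g B"
    and "g \<ge> 2"
    and "\<kappa> \<le> K"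
    and "K - \<kappa> \<in> {0..g - 2}"
  shows "\<exists>Sc :: ('k, 'f) scheme.
           based_on J C Cov Sc \<and>
           valid_scheme J Sc \<kappa> \<and>
           card (nodes J) = K \<and>
           robust J Sc \<kappa> \<and>
           has_computation_load J Sc r \<and>
           communication_load J Sc \<kappa> = 2 / real g * (1 - real r / real K) \<and>
           card (subfiles J) = F"
proof -
  have fin: "finite (nodes J)" "finite (subfiles J)" and ne: "nodes J \<noteq> {}"
    and beta: "beta J \<ge> 1" and T: "iva_bits J \<ge> 1" and FK: "card (nodes J) \<le> card (subfiles J)"
    and union: "(\<Union>k\<in>nodes J. reduce_set J k) = {1..num_functions J}"
    using assms(1) by (auto simp: valid_job_def)
  have cards: "card (nodes J) = K" "card (subfiles J) = F"
    and zeros: "\<forall>f\<in>subfiles J. card {k \<in> nodes J. C k f = 0} = r"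
    using assms(2) by (auto simp: computing_matrix_def binary_matrix_def)
  \<comment> \<open>Both occur in the denominator of the load; \<open>F > 0\<close> follows from
    \<open>K \<le> F\<close>.\<close>
  have "K > 0" and "F > 0"
    using ne fin FK cards by (auto simp: card_gt_0_iff)
  \<comment> \<open>Any column witnesses \<open>r \<le> K\<close>, which later turns the truncated
    \<open>K - r\<close> into a real difference.\<close>
  obtain f0 where "f0 \<in> subfiles J"
    using \<open>F > 0\<close> cards by (metis card.empty ex_in_conv less_irrefl)
  then have "r \<le> K"
    using zeros cards fin card_mono [of "nodes J" "{k \<in> nodes J. C k f0 = 0}"] by auto
  have sub: "identity_submatrix (nodes J) (subfiles J) C g B" if "B \<in> Cov" for B
    using assms(5) that by blast
  have finCov: "finite Cov"
    by (rule finite_cover [OF assms(5) fin])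
  have rows: "fst B \<subseteq> nodes J" "snd B \<subseteq> subfiles J" "card (fst B) = g" if "B \<in> Cov" for B
    using sub [OF that] by (auto simp: identity_submatrix_def split: prod.splits)
  define Sc0 where "Sc0 = coded_scheme_without_decoder J C Cov"
  have Sc0 [simp]: "assigned Sc0 = (\<lambda>k. {f \<in> subfiles J. C k f = 0})"
    "early_ivas Sc0 = (\<lambda>k. subphase1 J C k \<union> subphase2 J C Cov k)"
    "msg_bits Sc0 = (\<lambda>P k. iva_bits J * card (chunks J Cov P k))"
    "encode Sc0 = coded_message J C Cov"
    by (simp_all add: Sc0_def coded_scheme_without_decoder_def)
  define Sc where "Sc = with_consistent_decoder J Sc0"
  \<comment> \<open>Here \<open>card P = K - \<kappa> \<le> g - 2\<close>, and
    \<open>g \<ge> 2\<close> makes this subtraction exact, so two of the \<open>g\<close> rows are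
    active.\<close>
  have snd2: "senders P B \<subseteq> fst B - P \<and> card (senders P B) = 2"
    if "P \<in> straggler_sets J \<kappa>" "B \<in> Cov" for P B
  proof -
    have "finite P"
      using that(1) fin finite_subset by (auto simp: straggler_sets_def)
    moreover have "card P + 2 \<le> card (fst B)"
      using that(1) rows(3) [OF that(2)] cards assms(6,8) by (auto simp: straggler_sets_def)
    ultimately show ?thesis
      using senders by blast
  qed
  have "based_on J C Cov Sc"
    by (simp add: based_on_def Sc_def)
  moreover have "valid_scheme J Sc \<kappa>"
  proof -
    have "subphase1 J C k \<subseteq> {1..num_functions J} \<times> {f \<in> subfiles J. C k f = 0}"
      if "k \<in> nodes J" for k
      using union that by (auto simp: subphase1_def)
    moreover have "subphase2 J C Cov k \<subseteq> {1..num_functions J} \<times> {f \<in> subfiles J. C k f = 0}"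
      if "k \<in> nodes J" for k
    proof
      fix x assume "x \<in> subphase2 J C Cov k"
      then obtain R D k' f b where x: "x = (fn J k' b, f)" "(R, D) \<in> Cov" "k \<in> R" "k' \<in> R"
        "f \<in> D" "C k' f = 1" "k' \<noteq> k" "b \<in> {1..beta J}"
        by (auto simp: subphase2_def)
      have "k' \<in> nodes J" "f \<in> subfiles J"
        using rows [OF x(2)] x by auto
      moreover have "fn J k' b \<in> {1..num_functions J}"
        unfolding union [symmetric] reduce_set_def using x(8) \<open>k' \<in> nodes J\<close> by blast
      moreover have "C k f = 0"
        using identity_submatrix_zero [OF sub [OF x(2)]] x by blast
      ultimately show "x \<in> {1..num_functions J} \<times> {f \<in> subfiles J. C k f = 0}"
        using x(1) by simp
    qed
    ultimately show ?thesis
      by (simp add: valid_scheme_def Sc_def length_coded_message finCov)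
  qed
  moreover have "robust J Sc \<kappa>"
    unfolding robust_def
  proof (intro ballI allI impI)
    fix P v k
    assume P: "P \<in> straggler_sets J \<kappa>" and v: "iva_family J v" and k: "k \<in> nodes J"
    have "recovers J Sc P v k"
      unfolding Sc_def
    proof (rule recovers_with_consistent_decoder [OF v])
      fix u q f
      assume u: "iva_family J u" and bc: "broadcasts J Sc0 P u = broadcasts J Sc0 P v"
        and view: "local_view J Sc0 P u k = local_view J Sc0 P v k"
        and q: "q \<in> reduce_set J k" and f: "f \<in> subfiles J - assigned Sc0 k"
      obtain b where b: "q = fn J k b" "b \<in> {1..beta J}"
        using q by (auto simp: reduce_set_def)
      have "f \<in> subfiles J" "C k f \<noteq> 0"
        using f by auto
      then obtain B where B: "B \<in> Cov" "covers C B k f"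
        using assms(3) k unfolding identity_submatrix_cover_def by blast
      then have kf: "k \<in> fst B" "f \<in> snd B" "C k f = 1"
        by (auto simp: covers_def)
      then have col: "column_of C B k = f"
        by (intro column_of_eq [OF sub [OF B(1)]])
      \<comment> \<open>With two senders, one differs from \<open>k\<close> even if \<open>k\<close>
        is itself a sender.\<close>
      have "\<not> senders P B \<subseteq> {k}"
        using snd2 [OF P B(1)] card_mono [of "{k}" "senders P B"] by auto
      then obtain s where s: "s \<in> senders P B" "s \<in> fst B" "s \<notin> P" "s \<noteq> k"
        using snd2 [OF P B(1)] by blast
      have msg: "coded_message J C Cov P s (local_view J Sc0 P u s)
          = coded_message J C Cov P s (local_view J Sc0 P v s)"
        using fun_cong [OF bc, of s] s rows [OF B(1)] by (auto simp: broadcasts_def)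
      have "finite (fst B)"
        using rows [OF B(1)] fin finite_subset by blast
      then have "u (q, f) ! i = v (q, f) ! i" if "i < iva_bits J" for i
        using message_determines_missing_iva [OF sub [OF B(1)] B(1) finCov _ b(2) s(1,2) kf(1) _ _ msg view that]
          s(4) col b(1) by auto
      \<comment> \<open>Membership in the range of function indices gives both bit strings length
        \<open>iva_bits J\<close>, so bitwise equality suffices.\<close>
      moreover have "q \<in> {1..num_functions J}"
        unfolding union [symmetric] using q k by blast
      ultimately show "u (q, f) = v (q, f)"
        using u v \<open>f \<in> subfiles J\<close> by (auto simp: iva_family_def intro!: nth_equalityI)
    qed
    then show "recovers J Sc P v k \<and> reduces J Sc P v k"
      by (auto simp: Sc_def subphase1_def intro!: reduces_if_recovers)
  qed
  moreover have "has_computation_load J Sc r"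
    unfolding has_computation_load_def
  proof
    fix f assume f: "f \<in> subfiles J"
    then have "{k \<in> nodes J. f \<in> assigned Sc k} = {k \<in> nodes J. C k f = 0}"
      by (auto simp: Sc_def)
    then show "card {k \<in> nodes J. f \<in> assigned Sc k} = r"
      using zeros f by simp
  qed
  moreover have "communication_load J Sc \<kappa> = 2 / real g * (1 - real r / real K)"
  proof -
    have "g * card Cov = F * (K - r)"
      by (rule card_cover [OF assms(2-5)])
    then have count: "real g * real (card Cov) = real F * (real K - real r)"
      using \<open>r \<le> K\<close> by (metis of_nat_diff of_nat_mult)
    \<comment> \<open>The load does not depend on \<open>P\<close>: it is
      \<open>2 * beta J * iva_bits J * card Cov\<close> divided by
      \<open>beta J * K * F * iva_bits J\<close>, into which
      \<open>card Cov = F * (K - r) / g\<close> is inserted.\<close>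
    have load: "real (\<Sum>k\<in>nodes J - P. msg_bits Sc P k)
        / real (num_functions J * card (subfiles J) * iva_bits J)
        = 2 / real g * (1 - real r / real K)" if "P \<in> straggler_sets J \<kappa>" for P
    proof -
      have "senders P B \<subseteq> nodes J - P \<and> card (senders P B) = 2" if "B \<in> Cov" for B
        using snd2 [OF \<open>P \<in> _\<close> that] rows [OF that] by blast
      then have "(\<Sum>k\<in>nodes J - P. msg_bits Sc P k) = iva_bits J * (2 * beta J * card Cov)"
        by (simp add: Sc_def sum_card_chunks [OF fin(1) finCov] flip: sum_distrib_left)
      moreover have "real (card Cov) = real F * (real K - real r) / real g"
        using count assms(6) by (simp add: field_simps)
      ultimately show ?thesis
        using \<open>K > 0\<close> \<open>F > 0\<close> beta T assms(6) cards
        by (simp add: num_functions_def field_simps)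
    qed
    \<comment> \<open>\<open>Max\<close> is meaningful only on a nonempty set, so some straggler set
      must exist; the set of loads is then a singleton.\<close>
    obtain P where "P \<subseteq> nodes J" "card P = card (nodes J) - \<kappa>"
      using obtain_subset_with_card_n [of "card (nodes J) - \<kappa>" "nodes J"] by auto
    then have "straggler_sets J \<kappa> \<noteq> {}"
      by (auto simp: straggler_sets_def)
    then have "(\<lambda>P. real (\<Sum>k\<in>nodes J - P. msg_bits Sc P k)
        / real (num_functions J * card (subfiles J) * iva_bits J)) ` straggler_sets J \<kappa>
        = {2 / real g * (1 - real r / real K)}"
      using load by fastforce
    then show ?thesis
      unfolding communication_load_def by (metis Max_singleton)
  qed
  ultimately show ?thesis
    using cards by blast
qed

end
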